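(* Let $m \ge 2$ and $k \ge 2$ be integers with $m$ even. Then for every $v \in H - x_1$, that is, for every $v = (v_1,\ldots,v_k) \in (\mathbb{Z}_m)^k$ with $v_1 + \cdots + v_k \equiv -1 \pmod{m}$, there is a hamiltonian path from $0$ to $v$ in the Cayley digraph $\overrightarrow{\operatorname{Cay}}\bigl((\mathbb{Z}_m)^k\bigr)$.
   Context: For a finite abelian group $\Gamma$ with generating set $S$, the Cayley digraph $\overrightarrow{\operatorname{Cay}}(\Gamma;S)$ has vertex set $\Gamma$ and an arc from $g$ to $g+s$ whenever $g \in \Gamma$ and $s \in S \smallsetminus \{0\}$. $\overrightarrow{\operatorname{Cay}}\bigl((\mathbb{Z}_m)^k\bigr)$ means $\overrightarrow{\operatorname{Cay}}\bigl((\mathbb{Z}_m)^k;S\bigr)$ where $S = \{x_1,\ldots,x_k\}$ is the standard generating set ($x_i$ has $i$-th coordinate $1$ and all other coordinates $0$). The arc-forcing subgroup is $H = \{(v_1,\ldots,v_k) \in (\mathbb{Z}_m)^k \mid v_1+\cdots+v_k \equiv 0 \pmod m\}$, and $H - x_1 = \{h - x_1 \mid h \in H\}$. A hamiltonian path from $0$ to $v$ is a directed path starting at $0$, ending at $v$, and visiting every vertex exactly once. *)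

theory Defs
  imports
    "HOL-Algebra.Algebra"
    "HOL-Number_Theory.Cong"
    "Graph_Theory.Vertex_Walk"
begin

text \<open>
  HOL-Algebra writes all groups multiplicatively, so for the additive groups considered here
  \<open>\<otimes>\<close>, \<open>\<one>\<close> and \<open>inv\<close> stand for addition, zero and negation.
  Arcs are pairs of vertices, so arcs are not repeated, and the removal of \<open>\<one>\<close> from \<open>S\<close> excludes loops.
\<close>

definition cayley_digraph :: "('a, 'c) monoid_scheme \<Rightarrow> 'a set \<Rightarrow> ('a, 'a \<times> 'a) pre_digraph" where
  "cayley_digraph G S =
     \<lparr> verts = carrier G,
       arcs = {(g, g \<otimes>\<^bsub>G\<^esub> s) | g s. g \<in> carrier G \<and> s \<in> S - {\<one>\<^bsub>G\<^esub>}},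
       tail = fst,
       head = snd \<rparr>"

text \<open>\<^const>\<open>vpath\<close> already demands that consecutive vertices are joined by arcs and that no vertex
  is repeated.\<close>

definition hamiltonian_path :: "('a, 'b) pre_digraph \<Rightarrow> 'a \<Rightarrow> 'a list \<Rightarrow> 'a \<Rightarrow> bool" where
  "hamiltonian_path D u p v \<longleftrightarrow> vpath p D \<and> hd p = u \<and> last p = v \<and> set p = verts D"

text \<open>The elements of \<open>(\<int>\<^sub>m)\<^sup>k\<close> are the functions on \<open>{1..k}\<close> with values in \<open>{0..<m}\<close> (for \<open>m > 0\<close>),
  extended by \<^const>\<open>undefined\<close> outside \<open>{1..k}\<close>.\<close>

definition Zmod_power :: "nat \<Rightarrow> nat \<Rightarrow> (nat \<Rightarrow> int) monoid" where
  "Zmod_power m k = product_group {1..k} (\<lambda>_. integer_mod_group m)"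

text \<open>The reduction of \<open>1\<close> modulo \<open>m\<close> only matters in the degenerate case \<open>m = 1\<close>.\<close>

definition std_gen :: "nat \<Rightarrow> nat \<Rightarrow> nat \<Rightarrow> nat \<Rightarrow> int" where
  "std_gen m k i = (\<lambda>j\<in>{1..k}. if j = i then 1 mod int m else 0)"

definition cayley_Zmod_power :: "nat \<Rightarrow> nat \<Rightarrow> (nat \<Rightarrow> int, (nat \<Rightarrow> int) \<times> (nat \<Rightarrow> int)) pre_digraph" where
  "cayley_Zmod_power m k = cayley_digraph (Zmod_power m k) (std_gen m k ` {1..k})"

definition arc_forcing_subgroup :: "nat \<Rightarrow> nat \<Rightarrow> (nat \<Rightarrow> int) set" where
  "arc_forcing_subgroup m k = {v \<in> carrier (Zmod_power m k). [(\<Sum>i=1..k. v i) = 0] (mod int m)}"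

lemma group_Zmod_power: "group (Zmod_power m k)"
  by (simp add: Zmod_power_def)

lemma std_gen_carrier: "std_gen m k i \<in> carrier (Zmod_power m k)"
  by (auto simp: std_gen_def Zmod_power_def carrier_integer_mod_group)

lemma sum_std_gen: "i \<in> {1..k} \<Longrightarrow> (\<Sum>j=1..k. std_gen m k i j) = 1 mod int m"
  by (simp add: std_gen_def)

lemma sum_mult_Zmod_power:
  "[(\<Sum>i=1..k. (x \<otimes>\<^bsub>Zmod_power m k\<^esub> y) i) = (\<Sum>i=1..k. x i) + (\<Sum>i=1..k. y i)] (mod int m)"
proof -
  have "(\<Sum>i=1..k. (x \<otimes>\<^bsub>Zmod_power m k\<^esub> y) i) = (\<Sum>i=1..k. (x i + y i) mod int m)"
    by (simp add: Zmod_power_def)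
  moreover have "[(\<Sum>i=1..k. (x i + y i) mod int m) = (\<Sum>i=1..k. x i + y i)] (mod int m)"
    unfolding cong_def by (rule mod_sum_eq)
  ultimately show ?thesis
    by (simp only: sum.distrib)
qed

lemma mem_arc_forcing_coset_iff:
  assumes "k \<ge> 1"
  shows "v \<in> arc_forcing_subgroup m k #>\<^bsub>Zmod_power m k\<^esub> inv\<^bsub>Zmod_power m k\<^esub> std_gen m k 1
     \<longleftrightarrow> v \<in> carrier (Zmod_power m k) \<and> [(\<Sum>i=1..k. v i) = -1] (mod int m)"
proof -
  let ?G = "Zmod_power m k" and ?x = "std_gen m k 1"
  interpret group ?G by (rule group_Zmod_power)
  have x: "?x \<in> carrier ?G" by (rule std_gen_carrier)
  have "v \<in> arc_forcing_subgroup m k #>\<^bsub>?G\<^esub> inv\<^bsub>?G\<^esub> ?x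
     \<longleftrightarrow> v \<in> carrier ?G \<and> v \<otimes>\<^bsub>?G\<^esub> ?x \<in> arc_forcing_subgroup m k" (is "?L \<longleftrightarrow> ?R")
  proof
    assume ?L
    then obtain h where h: "h \<in> arc_forcing_subgroup m k" "v = h \<otimes>\<^bsub>?G\<^esub> inv\<^bsub>?G\<^esub> ?x"
      by (auto simp: r_coset_def)
    then have "h \<in> carrier ?G" by (simp add: arc_forcing_subgroup_def)
    then show ?R using h x by (simp add: m_assoc)
  next
    assume R: ?R
    then have "v = (v \<otimes>\<^bsub>?G\<^esub> ?x) \<otimes>\<^bsub>?G\<^esub> inv\<^bsub>?G\<^esub> ?x"
      using x by (simp add: m_assoc)
    then show ?L using R unfolding r_coset_def by blast
  qed
  moreover have "[(\<Sum>i=1..k. (v \<otimes>\<^bsub>?G\<^esub> ?x) i) = 0] (mod int m)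
     \<longleftrightarrow> [(\<Sum>i=1..k. v i) = -1] (mod int m)"
  proof -
    have "[(\<Sum>i=1..k. ?x i) = 1] (mod int m)"
      using sum_std_gen[of 1 k m] assms by (simp add: cong_def)
    then have "[(\<Sum>i=1..k. (v \<otimes>\<^bsub>?G\<^esub> ?x) i) = (\<Sum>i=1..k. v i) + 1] (mod int m)"
      by (rule cong_trans [OF sum_mult_Zmod_power cong_add [OF cong_refl]])
    then have "[(\<Sum>i=1..k. (v \<otimes>\<^bsub>?G\<^esub> ?x) i) = 0] (mod int m)
       \<longleftrightarrow> [(\<Sum>i=1..k. v i) + 1 = 0] (mod int m)"
      unfolding cong_def by (rule arg_cong)
    also have "\<dots> \<longleftrightarrow> [(\<Sum>i=1..k. v i) = -1] (mod int m)"
      unfolding cong_iff_dvd_diff by (simp only: diff_0_right diff_minus_eq_add)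
    finally show ?thesis .
  qed
  ultimately show ?thesis
    using x by (auto simp: arc_forcing_subgroup_def)
qed

end

theory Submission
  imports Defs
begin

text \<open>
  Since \<open>m\<close> is even and the coordinates of \<open>v\<close> sum to \<open>-1\<close>, some coordinate \<open>v\<^sub>i\<close> is odd. The remaining
  \<open>k - 1\<close> coordinates carry a hamiltonian cycle \<open>u\<close> of length \<open>n = m\<^sup>k\<^sup>-\<^sup>1\<close> (the modular Gray code), so the
  digraph contains the product of directed cycles of lengths \<open>n\<close> and \<open>m\<close>. There \<open>v\<close> becomes \<open>(a, -1 - a)\<close>
  with \<open>a\<close> even. Let a vertex with coordinate sum \<open>0\<close> modulo \<open>m\<close> always step in the \<open>n\<close>-cycle, and one with
  sum in \<open>{1..m-2}\<close> always in the \<open>m\<close>-cycle; a vertex \<open>(e, -1 - e)\<close> steps in the \<open>n\<close>-cycle if \<open>e < a\<close>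
  and in the \<open>m\<close>-cycle if \<open>e > a\<close>. The path from \<open>0\<close> then meets the vertices with sum \<open>-1\<close> at
  \<open>e = 1, 3, \<dots>, a - 1, a + 1, a + 2, \<dots>, n - 1, 0, 2, 4, \<dots>, a\<close>, that is, it meets all of them and stops at \<open>v\<close>.
\<close>

section \<open>Steps in a single coordinate\<close>

text \<open>The index set is arbitrary because the Gray code is built by adding coordinates one at a
  time and is then used on \<open>{1..k}\<close> without one coordinate.\<close>

definition unit_step :: "nat \<Rightarrow> 'a set \<Rightarrow> ('a \<Rightarrow> int) \<Rightarrow> ('a \<Rightarrow> int) \<Rightarrow> bool" where
  "unit_step m I g g' \<longleftrightarrow> (\<exists>i\<in>I. g' = g(i := (g i + 1) mod int m))"

lemma unit_step_fun_upd:
  assumes "unit_step m I g g'" "i \<notin> I"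
  shows "unit_step m (insert i I) (g(i := x)) (g'(i := x))"
proof -
  obtain j where "j \<in> I" "g' = g(j := (g j + 1) mod int m)"
    using assms(1) by (auto simp: unit_step_def)
  with assms(2) show ?thesis
    by (auto simp: unit_step_def fun_upd_twist intro!: bexI[of _ j])
qed

lemma unit_step_new_coordinate:
  assumes "[y = x + 1] (mod int m)"
  shows "unit_step m (insert i I) (g(i := x mod int m)) (g(i := y mod int m))"
  using assms by (auto simp: unit_step_def cong_def mod_simps)

lemma sum_unit_step:
  assumes "unit_step m I g g'" "finite I"
  shows "[sum g' I = sum g I + 1] (mod int m)"
proof -
  obtain j where j: "j \<in> I" "g' = g(j := (g j + 1) mod int m)"
    using assms(1) by (auto simp: unit_step_def)
  have "sum g' I = (g j + 1) mod int m + sum g (I - {j})"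
    using j assms(2) by (simp add: sum.remove[of I j])
  moreover have "sum g I = g j + sum g (I - {j})"
    using j assms(2) by (simp add: sum.remove[of I j])
  ultimately show ?thesis
    by (simp add: cong_def mod_simps algebra_simps)
qed

lemma Suc_div_mod_cases:
  fixes t m :: nat
  assumes "m > 0"
  obtains "Suc (t mod m) < m" "Suc t div m = t div m" "Suc t mod m = Suc (t mod m)"
  | "Suc (t mod m) = m" "Suc t div m = Suc (t div m)" "Suc t mod m = 0"
proof (cases "Suc (t mod m) = m")
  case True
  then show ?thesis by (intro that(2)) (simp_all add: div_Suc mod_Suc)
next
  case False
  moreover have "Suc (t mod m) \<le> m" using assms by (simp add: Suc_leI)
  ultimately show ?thesis by (intro that(1)) (simp_all add: div_Suc mod_Suc)
qed

text \<open>Both functions are \<open>undefined\<close> at \<open>i\<close>, so overwriting that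
  value loses no information.\<close>

lemma fun_upd_inj_PiE:
  assumes "g \<in> Pi\<^sub>E I F" "g' \<in> Pi\<^sub>E I F" "i \<notin> I" "g(i := x) = g'(i := y)"
  shows "g = g'"
proof
  fix j show "g j = g' j"
    using assms(1-3) fun_cong[OF assms(4), of j] by (cases "j = i") (auto simp: PiE_iff extensional_def)
qed

section \<open>The modular Gray code\<close>

text \<open>Induction on \<open>I\<close>: block \<open>q\<close> of \<open>m\<close> consecutive
  times stays at \<open>u q\<close> while the new coordinate runs through all residues, from
  \<open>-q\<close> to \<open>-q - 1\<close>. The next block starts at that last residue, so between
  blocks only the old cycle advances.\<close>

lemma gray_cycle_exists:
  assumes "finite I" "I \<noteq> {}" "m \<ge> 2"
  shows "\<exists>u :: nat \<Rightarrow> 'a \<Rightarrow> int.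
    u 0 = (\<lambda>i\<in>I. 0) \<and> (\<forall>t. u (t + m ^ card I) = u t) \<and> inj_on u {..<m ^ card I} \<and>
    (\<forall>t. u t \<in> (I \<rightarrow>\<^sub>E {0..<int m})) \<and> (\<forall>t. unit_step m I (u t) (u (Suc t)))"
  using assms(1,2)
proof (induction I rule: finite_ne_induct)
  case (singleton i)
  define u :: "nat \<Rightarrow> 'a \<Rightarrow> int" where "u t = (\<lambda>j\<in>{i}. int t mod int m)" for t
  have "inj_on u {..<m ^ card {i}}"
  proof
    fix t t' assume "t \<in> {..<m ^ card {i}}" "t' \<in> {..<m ^ card {i}}" "u t = u t'"
    then have "t < m" "t' < m" "u t i = u t' i" by simp_all
    then show "t = t'" by (simp add: u_def)
  qed
  moreover have "\<forall>t. unit_step m {i} (u t) (u (Suc t))"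
    by (auto simp: u_def unit_step_def fun_eq_iff mod_simps algebra_simps)
  moreover have "u 0 = (\<lambda>i\<in>{i}. 0)" "\<forall>t. u (t + m ^ card {i}) = u t"
    "\<forall>t. u t \<in> ({i} \<rightarrow>\<^sub>E {0..<int m})"
    using assms(3) by (auto simp: u_def)
  ultimately show ?case
    by blast
next
  case (insert i I)
  define n where "n = m ^ card I"
  from insert.IH obtain u :: "nat \<Rightarrow> 'a \<Rightarrow> int" where u0: "u 0 = (\<lambda>i\<in>I. 0)"
    and period: "\<And>t. u (t + n) = u t" and inj: "inj_on u {..<n}"
    and range: "\<And>t. u t \<in> (I \<rightarrow>\<^sub>E {0..<int m})" and step: "\<And>t. unit_step m I (u t) (u (Suc t))"
    unfolding n_def by blast
  have m: "m > 0" using assms(3) by simp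
  have card: "m ^ card (insert i I) = n * m"
    using insert.hyps by (simp add: n_def)
  \<comment> \<open>As \<open>I\<close> is nonempty, the exponent is positive; hence the offsets
    \<open>-q\<close> also repeat after \<open>n\<close> blocks and the cycle closes.\<close>
  have dvd: "int m dvd int n"
    using insert.hyps by (auto simp: n_def card_gt_0_iff intro!: dvd_power)
  define w :: "nat \<Rightarrow> 'a \<Rightarrow> int"
    where "w t = (u (t div m))(i := (int (t mod m) - int (t div m)) mod int m)" for t
  have "w 0 = (\<lambda>i\<in>insert i I. 0)"
    using u0 insert.hyps by (auto simp: w_def fun_eq_iff)
  moreover have "w (t + n * m) = w t" for t
  proof -
    have "(t + n * m) div m = t div m + n" using m by simp
    moreover have "(int (t mod m) - int (t div m + n)) mod int m = (int (t mod m) - int (t div m)) mod int m"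
      using dvd by (simp add: mod_eq_dvd_iff)
    ultimately show ?thesis unfolding w_def by (simp only: period mod_mult_self1)
  qed
  moreover have "inj_on w {..<n * m}"
  proof
    fix t t' assume t: "t \<in> {..<n * m}" "t' \<in> {..<n * m}" and eq: "w t = w t'"
    have "u (t div m) = u (t' div m)"
      using eq unfolding w_def by (rule fun_upd_inj_PiE[OF range range insert.hyps(3)])
    moreover have "t div m < n" "t' div m < n"
      using t by (simp_all add: less_mult_imp_div_less)
    ultimately have q: "t div m = t' div m"
      using inj by (auto dest: inj_onD)
    have "[int (t mod m) - int (t div m) = int (t' mod m) - int (t div m)] (mod int m)"
      using fun_cong[OF eq, of i] q by (simp add: w_def cong_def)
    then have "[int (t mod m) = int (t' mod m)] (mod int m)"
      by (simp add: cong_iff_dvd_diff)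
    then have "t mod m = t' mod m"
      using m by (simp add: cong_int_iff cong_def)
    with q show "t = t'" by (metis mod_mult_div_eq)
  qed
  moreover have "w t \<in> (insert i I \<rightarrow>\<^sub>E {0..<int m})" for t
    using range[of "t div m"] m by (auto simp: w_def PiE_iff extensional_def)
  moreover have "unit_step m (insert i I) (w t) (w (Suc t))" for t
    using m
  proof (cases rule: Suc_div_mod_cases[where t = t])
    case 1
    show ?thesis unfolding w_def 1 by (rule unit_step_new_coordinate) (simp add: cong_def algebra_simps)
  next
    case 2
    then have "int (t mod m) = int m - 1" by linarith
    then have "(int (t mod m) - int (t div m)) mod int m = (int 0 - int (Suc (t div m))) mod int m"
      by (simp add: mod_eq_dvd_iff)
    then show ?thesis unfolding w_def 2
      using unit_step_fun_upd[OF step insert.hyps(3)] by simp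
  qed
  ultimately show ?case unfolding card by blast
qed

section \<open>Hamiltonian paths in a product of two directed cycles\<close>

text \<open>Continuing past \<open>n - 1\<close> with \<open>n, n + 2, \<dots>, n + 2 h\<close> instead of \<open>0, 2, \<dots>, 2 h\<close> makes the sequence increasing.\<close>

definition visit :: "nat \<Rightarrow> nat \<Rightarrow> nat \<Rightarrow> nat" where
  "visit n h q = (if q < h then 2 * q + 1 else if q < n - h then q + h + 1 else 2 * (q + h + 1) - n)"

lemma visit_pos: "2 * h < n \<Longrightarrow> visit n h q > 0"
  by (auto simp: visit_def)

lemma visit_0: "2 * h < n \<Longrightarrow> visit n h 0 = 1"
  by (auto simp: visit_def)

lemma visit_last: "2 * h < n \<Longrightarrow> visit n h (n - 1) = n + 2 * h"
  by (auto simp: visit_def)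

text \<open>An increment always contains the step in the \<open>n\<close>-cycle forced at sum
  \<open>0\<close>. It is \<open>2\<close> if the preceding vertex with sum \<open>-1\<close> also
  steps in the \<open>n\<close>-cycle, and \<open>1\<close> if that vertex steps in the
  \<open>m\<close>-cycle.\<close>

lemma visit_Suc:
  "2 * h < n \<Longrightarrow> visit n h (Suc q) = visit n h q + 1 \<or> visit n h (Suc q) = visit n h q + 2"
  by (auto simp: visit_def)

text \<open>The values are distinct and lie strictly between \<open>0\<close> and
  \<open>2 * n\<close>, so congruent ones could only differ by \<open>n\<close>. A value above
  \<open>n\<close> is \<open>n\<close> plus an even number at most \<open>2 * h\<close>, whereas all
  values up to \<open>2 * h\<close> are odd.\<close>

lemma visit_inj_mod:
  assumes "2 * h < n" "even n" "q < n" "q' < n" "[visit n h q = visit n h q'] (mod n)"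
  shows "q = q'"
proof -
  have inj: "q = q'" if "visit n h q = visit n h q'" for q q'
    using that assms(1) by (auto simp: visit_def split: if_splits; presburger)
  have no: False if "q < n" "visit n h q = visit n h q' + n" for q q'
  proof -
    have "visit n h q > n" using that visit_pos[OF assms(1), of q'] by simp
    then have q: "\<not> q < n - h" using assms(1) by (auto simp: visit_def split: if_splits)
    then have "visit n h q + n = 2 * (q + h + 1)" using assms(1) by (auto simp: visit_def)
    then have "even (visit n h q')" "visit n h q' \<le> 2 * h"
      using that assms(2) by presburger+
    then show False using assms(1) by (auto simp: visit_def split: if_splits)
  qed
  have bound: "visit n h q < 2 * n" if "q < n" for q
    using that assms(1) by (auto simp: visit_def)
  have "x = y \<or> x = y + n \<or> y = x + n" if "x < 2 * n" "y < 2 * n" "[x = y] (mod n)" for x y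
    using that by (cases "x < n"; cases "y < n") (auto simp: cong_def le_mod_geq)
  then have "visit n h q = visit n h q' \<or> visit n h q = visit n h q' + n \<or> visit n h q' = visit n h q + n"
    using bound assms(3-5) by simp
  then show ?thesis using inj no assms(3,4) by blast
qed

lemma product_path:
  fixes u :: "nat \<Rightarrow> 'a \<Rightarrow> int"
  assumes m: "m \<ge> 2" and n: "2 * h < n" "even n" "m dvd n"
    and i: "i \<notin> I"
    and period: "\<And>t. u (t + n) = u t" and inj: "inj_on u {..<n}"
    and range: "\<And>t. u t \<in> (I \<rightarrow>\<^sub>E {0..<int m})" and step: "\<And>t. unit_step m I (u t) (u (Suc t))"
  shows "\<exists>w. w 0 = (u 0)(i := 0) \<and> w (n * m - 1) = (u (2 * h))(i := (-1 - int (2 * h)) mod int m) \<and>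
    inj_on w {..<n * m} \<and> (\<forall>t. w t \<in> (insert i I \<rightarrow>\<^sub>E {0..<int m})) \<and>
    (\<forall>t. unit_step m (insert i I) (w t) (w (Suc t)))"
proof -
  \<comment> \<open>The vertex at time \<open>t\<close> has sum \<open>t mod m\<close>. Block
    \<open>q = t div m\<close> opens at sum \<open>0\<close>, one position before
    \<open>visit n h q\<close>; a step in the \<open>n\<close>-cycle reaches that position, which is
    then kept until sum \<open>-1\<close>.\<close>
  define pos where "pos t = visit n h (t div m) - (if t mod m = 0 then 1 else 0)" for t
  define w where "w t = (u (pos t))(i := (int (t mod m) - int (pos t)) mod int m)" for t
  have m0: "m > 0" using m by simp
  have dvd: "int m dvd int n" using n(3) by simp
  have u_mod: "u (t mod n) = u t" for t
  proof -
    have "u (a + b * n) = u a" for a b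
      by (induction b) (simp_all add: period add.assoc[symmetric] add.commute[of n])
    from this[of "t mod n" "t div n"] show ?thesis by simp
  qed
  have "w 0 = (u 0)(i := 0)"
    using n(1) by (simp add: w_def pos_def visit_0)
  moreover have "w (n * m - 1) = (u (2 * h))(i := (-1 - int (2 * h)) mod int m)"
  proof -
    have "n * m - 1 = (m - 1) + m * (n - 1)"
      using m0 n(1) by (simp add: algebra_simps)
    then have "(n * m - 1) div m = n - 1" "(n * m - 1) mod m = m - 1"
      using m0 div_mult_self2[of m "m - 1" "n - 1"] mod_mult_self2[of "m - 1" m "n - 1"]
      by (simp_all only:) simp_all
    moreover have "(int (m - 1) - int (n + 2 * h)) mod int m = (-1 - int (2 * h)) mod int m"
      using m0 dvd by (simp add: mod_eq_dvd_iff of_nat_diff)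
    moreover have "u (n + 2 * h) = u (2 * h)"
      using period[of "2 * h"] by (simp add: add.commute)
    ultimately show ?thesis
      using m visit_last[OF n(1)] by (simp add: w_def pos_def del: of_nat_add)
  qed
  moreover have "inj_on w {..<n * m}"
  proof
    fix t t' assume t: "t \<in> {..<n * m}" "t' \<in> {..<n * m}" and eq: "w t = w t'"
    have "u (pos t) = u (pos t')"
      using eq unfolding w_def by (rule fun_upd_inj_PiE[OF range range i])
    then have "u (pos t mod n) = u (pos t' mod n)" by (simp add: u_mod)
    then have pos: "[pos t = pos t'] (mod n)"
      using inj n(1) by (auto simp: cong_def dest: inj_onD)
    \<comment> \<open>Since \<open>m\<close> divides \<open>n\<close>, coordinate \<open>i\<close>
      reveals \<open>t mod m\<close>; then the shift in \<open>pos\<close> is known and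
      \<open>visit_inj_mod\<close> recovers \<open>t div m\<close>.\<close>
    then have "[int (pos t) = int (pos t')] (mod int m)"
      using n(3) by (simp add: cong_int_iff cong_dvd_modulus_nat)
    moreover have "[int (t mod m) - int (pos t) = int (t' mod m) - int (pos t')] (mod int m)"
      using fun_cong[OF eq, of i] by (simp add: w_def cong_def)
    ultimately have "[int (t mod m) - int (pos t) + int (pos t) = int (t' mod m) - int (pos t') + int (pos t')] (mod int m)"
      by (intro cong_add)
    then have "[int (t mod m) = int (t' mod m)] (mod int m)" by simp
    then have r: "t mod m = t' mod m"
      unfolding cong_int_iff by (simp add: cong_def)
    have "pos s + (if s mod m = 0 then 1 else 0) = visit n h (s div m)" for s
      using visit_pos[OF n(1), of "s div m"] by (simp add: pos_def)
    then have "[visit n h (t div m) = visit n h (t' div m)] (mod n)"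
      using cong_add[OF pos cong_refl] r by metis
    then have "t div m = t' div m"
      using t by (intro visit_inj_mod[OF n(1,2)]) (simp_all add: less_mult_imp_div_less)
    with r show "t = t'" by (metis mod_mult_div_eq)
  qed
  moreover have "w t \<in> (insert i I \<rightarrow>\<^sub>E {0..<int m})" for t
    using range[of "pos t"] m0 by (auto simp: w_def PiE_iff extensional_def)
  moreover have "unit_step m (insert i I) (w t) (w (Suc t))" for t
  proof -
    \<comment> \<open>Sum and position grow together, so coordinate \<open>i\<close> is unchanged
      and only the \<open>n\<close>-cycle moves.\<close>
    have cycle_step: ?thesis
      if "pos (Suc t) = Suc (pos t)" "[int (Suc t mod m) = int (t mod m) + 1] (mod int m)"
    proof -
      have "[int (Suc t mod m) - int (pos (Suc t)) = int (t mod m) + 1 - (1 + int (pos t))] (mod int m)"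
        using that by (intro cong_diff) simp_all
      then have "(int (Suc t mod m) - int (pos (Suc t))) mod int m = (int (t mod m) - int (pos t)) mod int m"
        by (simp add: cong_def)
      then show ?thesis
        using unit_step_fun_upd[OF step i] that(1) by (simp add: w_def)
    qed
    have new_step: ?thesis
      if "pos (Suc t) = pos t" "[int (Suc t mod m) = int (t mod m) + 1] (mod int m)"
    proof -
      have "[int (Suc t mod m) - int (pos t) = int (t mod m) + 1 - int (pos t)] (mod int m)"
        using that by (intro cong_diff) simp_all
      then show ?thesis
        unfolding w_def that(1) by (intro unit_step_new_coordinate) (simp add: algebra_simps)
    qed
    have "[int (Suc t mod m) = int (t mod m) + 1] (mod int m)"
      by (simp add: cong_def of_nat_mod mod_simps add.commute)
    moreover have "pos (Suc t) = Suc (pos t) \<or> pos (Suc t) = pos t"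
      using m0
    proof (cases rule: Suc_div_mod_cases[where t = t])
      case 1
      then show ?thesis
        using visit_pos[OF n(1), of "t div m"] by (auto simp: pos_def)
    next
      case 2
      \<comment> \<open>As \<open>m \<ge> 2\<close>, the end of a block is not its beginning, so
        \<open>pos t\<close> is the unshifted value; the increment \<open>1\<close> or
        \<open>2\<close>, less the shift opening the next block, is \<open>0\<close> or
        \<open>1\<close>.\<close>
      then have "t mod m \<noteq> 0" using m by auto
      with 2 show ?thesis
        using visit_Suc[OF n(1), of "t div m"] by (auto simp: pos_def)
    qed
    ultimately show ?thesis using cycle_step new_step by blast
  qed
  ultimately show ?thesis by blast
qed

section \<open>Translation to the Cayley digraph\<close>

lemma carrier_Zmod_power: "m > 0 \<Longrightarrow> carrier (Zmod_power m k) = ({1..k} \<rightarrow>\<^sub>E {0..<int m})"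
  by (simp add: Zmod_power_def carrier_integer_mod_group)

lemma mult_std_gen:
  assumes "g \<in> carrier (Zmod_power m k)" "i \<in> {1..k}" "m > 0"
  shows "g \<otimes>\<^bsub>Zmod_power m k\<^esub> std_gen m k i = g(i := (g i + 1) mod int m)"
proof
  fix j
  have "g \<in> ({1..k} \<rightarrow>\<^sub>E {0..<int m})" using assms by (simp add: carrier_Zmod_power)
  then show "(g \<otimes>\<^bsub>Zmod_power m k\<^esub> std_gen m k i) j = (g(i := (g i + 1) mod int m)) j"
    using assms(2) by (cases "j \<in> {1..k}") (auto simp: Zmod_power_def std_gen_def mod_simps PiE_iff extensional_def)
qed

lemma unit_step_arc:
  assumes "unit_step m {1..k} g g'" "g \<in> carrier (Zmod_power m k)" "m \<ge> 2"
  shows "(g, g') \<in> arcs (cayley_Zmod_power m k)"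
proof -
  obtain i where i: "i \<in> {1..k}" "g' = g(i := (g i + 1) mod int m)"
    using assms(1) by (auto simp: unit_step_def)
  \<comment> \<open>Generators equal to \<open>\<one>\<close> give no arcs; coordinate
    \<open>i\<close> tells the two apart, as \<open>1 mod m\<close> is nonzero.\<close>
  have "std_gen m k i i \<noteq> \<one>\<^bsub>Zmod_power m k\<^esub> i"
    using i(1) assms(3) by (simp add: std_gen_def Zmod_power_def)
  then have "std_gen m k i \<in> std_gen m k ` {1..k} - {\<one>\<^bsub>Zmod_power m k\<^esub>}"
    using i(1) by auto
  moreover have "g' = g \<otimes>\<^bsub>Zmod_power m k\<^esub> std_gen m k i"
    using mult_std_gen[OF assms(2) i(1)] assms(3) i(2) by simp
  ultimately show ?thesis
    using assms(2) by (auto simp: cayley_Zmod_power_def cayley_digraph_def)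
qed

text \<open>Every vertex is met by counting: \<open>m ^ k\<close> distinct values fill a vertex set
  of that size.\<close>

lemma hamiltonian_path_of_sequence:
  assumes "m \<ge> 2" and inj: "inj_on w {..<m ^ k}"
    and range: "\<And>t. w t \<in> ({1..k} \<rightarrow>\<^sub>E {0..<int m})" and step: "\<And>t. unit_step m {1..k} (w t) (w (Suc t))"
  shows "hamiltonian_path (cayley_Zmod_power m k) (w 0) (map w [0..<m ^ k]) (w (m ^ k - 1))"
proof -
  let ?D = "cayley_Zmod_power m k" and ?p = "map w [0..<m ^ k]"
  have pos: "0 < m ^ k" using assms(1) by simp
  have verts: "verts ?D = ({1..k} \<rightarrow>\<^sub>E {0..<int m})"
    using assms(1) by (simp add: cayley_Zmod_power_def cayley_digraph_def carrier_Zmod_power)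
  have "w ` {..<m ^ k} = ({1..k} \<rightarrow>\<^sub>E {0..<int m})"
    using range card_image[OF inj] by (intro card_subset_eq) (auto simp: card_PiE intro: finite_PiE)
  then have set: "set ?p = verts ?D"
    by (simp add: verts lessThan_atLeast0)
  have arc: "(w t, w (Suc t)) \<in> arcs_ends ?D" for t
  proof -
    have "(w t, w (Suc t)) \<in> arcs ?D"
      using step range assms(1) by (intro unit_step_arc) (simp_all add: carrier_Zmod_power)
    then show ?thesis
      by (force simp: arcs_ends_def arc_to_ends_def cayley_Zmod_power_def cayley_digraph_def)
  qed
  have arcs: "set (vwalk_arcs (map w [0..<l])) \<subseteq> arcs_ends ?D" for l
  proof (induction l)
    case (Suc l)
    then show ?case
      using arc[of "l - 1"] by (cases "l = 0") (simp_all add: set_vwalk_arcs_snoc last_map)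
  qed simp
  have "vpath ?p ?D"
    using pos set arcs[of "m ^ k"] inj
    by (auto simp: vpath_def vwalk_def distinct_map lessThan_atLeast0)
  then show ?thesis
    using pos set by (simp add: hamiltonian_path_def hd_map last_map)
qed

theorem corollary3p4:
  fixes m k :: nat and v :: "nat \<Rightarrow> int"
  assumes "m \<ge> 2" and "k \<ge> 2" and "even m"
    and "v \<in> arc_forcing_subgroup m k #>\<^bsub>Zmod_power m k\<^esub> inv\<^bsub>Zmod_power m k\<^esub> std_gen m k 1"
  shows "\<exists>p. hamiltonian_path (cayley_Zmod_power m k) \<one>\<^bsub>Zmod_power m k\<^esub> p v"
proof -
  have v: "v \<in> ({1..k} \<rightarrow>\<^sub>E {0..<int m})" and sum_v: "[sum v {1..k} = -1] (mod int m)"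
    using assms mem_arc_forcing_coset_iff[of k v m] by (simp_all add: carrier_Zmod_power)
  have even_cong: "even x \<longleftrightarrow> even y" if "[x = y] (mod int m)" for x y
  proof -
    have "2 dvd x - y" using that assms(3) by (meson cong_iff_dvd_diff dvd_trans even_of_nat)
    then show ?thesis by simp
  qed
  have "odd (sum v {1..k})"
    using even_cong[OF sum_v] by simp
  then obtain i where i: "i \<in> {1..k}" "odd (v i)"
    by (meson dvd_sum)
  define I where "I = {1..k} - {i}"
  define n where "n = m ^ card I"
  have I: "finite I" "i \<notin> I" "insert i I = {1..k}" "card I = k - 1"
    using i(1) by (auto simp: I_def)
  then have "I \<noteq> {}" using assms(2) by auto
  then obtain u :: "nat \<Rightarrow> nat \<Rightarrow> int" where u0: "u 0 = (\<lambda>i\<in>I. 0)"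
    and period: "\<And>t. u (t + n) = u t" and inj: "inj_on u {..<n}"
    and range: "\<And>t. u t \<in> (I \<rightarrow>\<^sub>E {0..<int m})" and step: "\<And>t. unit_step m I (u t) (u (Suc t))"
    using gray_cycle_exists[OF I(1) _ assms(1)] unfolding n_def by blast
  have dvd: "m dvd n"
    using assms(2) I(4) by (auto simp: n_def intro!: dvd_power)
  have nm: "n * m = m ^ k"
    using assms(2) by (cases k) (simp_all add: n_def I(4))
  \<comment> \<open>The Gray cycle fills its range by counting, so the other coordinates of
    \<open>v\<close> form some \<open>u a\<close>.\<close>
  have "u ` {..<n} = (I \<rightarrow>\<^sub>E {0..<int m})"
    using range card_image[OF inj] I(1)
    by (intro card_subset_eq) (auto simp: card_PiE n_def intro: finite_PiE)
  moreover have "restrict v I \<in> (I \<rightarrow>\<^sub>E {0..<int m})"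
    using v by (auto simp: I_def)
  ultimately obtain a where a: "a < n" "u a = restrict v I"
    by (metis imageE lessThan_iff)
  \<comment> \<open>Position on the cycle equals coordinate sum modulo \<open>m\<close>; this turns
    the condition on \<open>v\<close> into one on \<open>v i\<close> and \<open>a\<close>.\<close>
  have sum_u: "[sum (u t) I = int t] (mod int m)" for t
  proof (induction t)
    case (Suc t)
    have "[sum (u (Suc t)) I = sum (u t) I + 1] (mod int m)"
      using sum_unit_step[OF step I(1)] .
    also have "[sum (u t) I + 1 = int t + 1] (mod int m)"
      using Suc by (intro cong_add) simp_all
    finally show ?case by (simp add: algebra_simps)
  qed (simp add: u0)
  have "sum v {1..k} = v i + sum (u a) I"
    using sum.remove[of "{1..k}" i v] i(1) a(2) by (simp add: I_def)
  then have "[v i + sum (u a) I - sum (u a) I = -1 - int a] (mod int m)"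
    using sum_v sum_u[of a] by (intro cong_diff) simp_all
  then have vi: "[v i = -1 - int a] (mod int m)" by simp
  \<comment> \<open>An odd \<open>v i\<close> forces the even position that
    \<open>product_path\<close> takes as \<open>2 * h\<close>.\<close>
  then have "even a" using even_cong[OF vi] i(2) by simp
  then obtain h where h: "a = 2 * h" by blast
  have "even n" using dvd assms(3) by auto
  then obtain w where w: "w 0 = (u 0)(i := 0)"
    "w (n * m - 1) = (u a)(i := (-1 - int a) mod int m)"
    "inj_on w {..<m ^ k}" "\<And>t. w t \<in> ({1..k} \<rightarrow>\<^sub>E {0..<int m})"
    "\<And>t. unit_step m {1..k} (w t) (w (Suc t))"
    using product_path[OF assms(1) _ _ dvd I(2) period inj range step, of h] a(1)
    unfolding h I(3) nm by blast
  have "w 0 = \<one>\<^bsub>Zmod_power m k\<^esub>"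
    using i(1) by (auto simp: w(1) u0 I_def Zmod_power_def fun_eq_iff)
  moreover have "w (m ^ k - 1) = v"
  proof -
    have "(-1 - int a) mod int m = v i"
      using vi v i(1) by (auto simp: cong_def PiE_iff)
    then show ?thesis
      using v unfolding nm[symmetric] w(2) a(2) I_def
      by (auto simp: fun_eq_iff PiE_iff extensional_def)
  qed
  ultimately show ?thesis
    using hamiltonian_path_of_sequence[OF assms(1) w(3-5)] by auto
qed

end
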